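(* Let $\beta=2$ and let $\alpha>-\tfrac12$ be fixed. For every $s\in\mathbb{C}$ with $\tfrac12<\mathrm{Re}(s)<\alpha+1$, the limit $$\mathcal{M}^{(2)}(-s,\alpha):=\lim_{N\to\infty}N^{-s}\,\mathcal{M}^{(2)}_N(-s,\alpha)$$ exists, and $$\mathcal{M}^{(2)}(-s,\alpha)=\frac{4^{s-1}\,\Gamma(\alpha+1-s)\,\Gamma\left(s-\frac12\right)}{\sqrt{\pi}\,\Gamma(s+1)\,\Gamma(s+\alpha)}.$$
   Context: For $\beta>0$, $\alpha>-1$ and $N\in\mathbb{N}$, the Laguerre $\beta$-ensemble is the probability measure on $(\lambda_1,\dots,\lambda_N)\in[0,\infty)^N$ whose density is proportional to $$\prod_{j=1}^N\lambda_j^{\alpha}e^{-\lambda_j}\prod_{1\le i<j\le N}|\lambda_j-\lambda_i|^{\beta}.$$ The inverse moments are $\mathcal{M}^{(\beta)}_N(-s,\alpha)=\mathbb{E}\left(\sum_{j=1}^N\lambda_j^{-s}\right)$, the expectation being with respect to this measure ($\lambda^{-s}=e^{-s\log\lambda}$ for $\lambda>0$). *)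

theory Defs
  imports "HOL-Analysis.Analysis"
begin

text \<open>
  Since the number \<open>N\<close> of eigenvalues tends to infinity, a point of \<open>\<real>\<^sup>N\<close> is a function on the index
  set \<open>{..<N}\<close> (an element of the product measure space \<open>\<Pi>\<^sub>M j\<in>{..<N}. lborel\<close>), the eigenvalues being
  \<open>x 0, \<dots>, x (N - 1)\<close>. Since \<open>0 powr a = 0\<close>, the weight is \<open>0\<close> rather than \<open>1\<close> or \<open>\<infinity>\<close> on the
  null set where some eigenvalue vanishes and \<open>\<alpha> \<le> 0\<close>.
\<close>

definition laguerre_weight :: "real \<Rightarrow> real \<Rightarrow> nat \<Rightarrow> (nat \<Rightarrow> real) \<Rightarrow> real" where
  "laguerre_weight \<beta> \<alpha> N x =
     (\<Prod>j<N. indicator {0..} (x j) * (x j powr \<alpha> * exp (- x j))) *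
     (\<Prod>j<N. \<Prod>i<j. \<bar>x j - x i\<bar> powr \<beta>)"

definition laguerre_ensemble :: "real \<Rightarrow> real \<Rightarrow> nat \<Rightarrow> (nat \<Rightarrow> real) measure" where
  "laguerre_ensemble \<beta> \<alpha> N =
     density (\<Pi>\<^sub>M j\<in>{..<N}. lborel)
       (\<lambda>x. ennreal (laguerre_weight \<beta> \<alpha> N x) /
            (\<integral>\<^sup>+ y. ennreal (laguerre_weight \<beta> \<alpha> N y) \<partial>(\<Pi>\<^sub>M j\<in>{..<N}. lborel)))"

text \<open>The (complex) moment of exponent \<open>z\<close>; the inverse moments are those with \<open>z = - s\<close>.\<close>

definition laguerre_moment :: "real \<Rightarrow> nat \<Rightarrow> complex \<Rightarrow> real \<Rightarrow> complex" where
  "laguerre_moment \<beta> N z \<alpha> =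
     (\<integral>x. (\<Sum>j<N. complex_of_real (x j) powr z) \<partial>(laguerre_ensemble \<beta> \<alpha> N))"

end

(*
  Write r(z,n) for the coefficient of t^n in (1-t)^(-z). For beta = 2 the squared Vandermonde product is
  the square of a determinant of Laguerre polynomials L_k^alpha, and orthogonality reduces the moment to
    sum_{k<N} int x^(alpha-s) e^(-x) L_k^alpha(x)^2 dx / h_k,   h_k = Gamma(alpha+1) r(alpha+1,k).
  Expanding L_k^alpha = sum_j r(s,k-j) L_j^(alpha-s), with L_j^(alpha-s) orthogonal for the complex weight
  x^(alpha-s) e^(-x), the integral becomes Gamma(alpha-s+1) sum_j r(s,k-j)^2 r(alpha-s+1,j). If
  a_m / r(p,m) tends to L, then the convolution of a with r(q,.), divided by r(p+q,.), also tends to L;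
  this gives the asymptotics of the inner sum (p = 2s-1, q = alpha-s+1) and of the sum over k (p = s, q = 1).
  The constant is put in its final form by Legendre's duplication formula.
*)
theory Submission
  imports Defs "Jordan_Normal_Form.Determinant"
begin

section \<open>Rising binomials: convolution and growth\<close>

text \<open>The generalized binomial coefficient of \<open>z + n - 1\<close> over \<open>n\<close>.
  As Taylor coefficients of powers of 1 / (1 - t), these sequences convolve by adding their
  parameters, which is why the sums below are written with them.\<close>

definition rising_binomial :: "'a::field_char_0 \<Rightarrow> nat \<Rightarrow> 'a" where
  "rising_binomial z n = pochhammer z n / fact n"

lemma rising_binomial_0 [simp]: "rising_binomial z 0 = 1"
  by (simp add: rising_binomial_def)

lemma rising_binomial_1 [simp]: "rising_binomial 1 n = 1"
  by (simp add: rising_binomial_def flip: pochhammer_fact)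

lemma of_real_rising_binomial:
  "rising_binomial (of_real x :: 'a::{real_field}) n = of_real (rising_binomial x n)"
  by (simp add: rising_binomial_def pochhammer_of_real)

lemma rising_binomial_pos: "x > 0 \<Longrightarrow> rising_binomial (x::real) n > 0"
  by (simp add: rising_binomial_def pochhammer_pos)

lemma rising_binomial_nonzero:
  fixes z :: complex
  assumes "Re z > 0"
  shows "rising_binomial z n \<noteq> 0"
proof -
  have "z \<noteq> - of_nat k" for k
    using assms by auto
  thus ?thesis by (simp add: rising_binomial_def pochhammer_eq_0_iff)
qed

text \<open>Coefficient comparison in (1 - t)^(-p) (1 - t)^(-q) = (1 - t)^(-(p + q)); formally the
  binomial theorem for Pochhammer symbols, divided by \<open>fact n\<close>.\<close>

lemma rising_binomial_Vandermonde:
  "rising_binomial (p + q) n = (\<Sum>j\<le>n. rising_binomial p (n - j) * rising_binomial q j)"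
proof -
  have "rising_binomial (q + p) n = (\<Sum>j\<le>n. rising_binomial q j * rising_binomial p (n - j))"
    unfolding rising_binomial_def pochhammer_binomial_sum sum_divide_distrib
    by (intro sum.cong refl) (simp add: binomial_fact field_simps)
  thus ?thesis by (simp add: add.commute mult.commute)
qed

lemma rising_binomial_minus:
  "rising_binomial (- b) n = (-1) ^ n * rising_binomial (b - of_nat n + 1) n"
  by (simp add: rising_binomial_def pochhammer_minus)

lemma Gamma_nonzero_of_Re_pos: "Re z > 0 \<Longrightarrow> Gamma z \<noteq> (0::complex)"
  by (auto simp: Gamma_eq_zero_iff elim!: nonpos_Ints_cases)

lemma of_nat_over_add_tendsto_1:
  fixes z :: complex
  shows "(\<lambda>n. of_nat n / (z + of_nat n)) \<longlonglongrightarrow> 1"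
proof -
  have "(\<lambda>n. 1 / (1 + z / of_nat n)) \<longlonglongrightarrow> 1 / (1 + 0)"
    by (intro tendsto_intros lim_const_over_n) simp
  moreover have "\<forall>\<^sub>F n in sequentially. 1 / (1 + z / of_nat n) = of_nat n / (z + of_nat n)"
    using eventually_gt_at_top[of 0] by eventually_elim (simp add: field_simps)
  ultimately show ?thesis by (simp add: tendsto_cong)
qed

text \<open>Euler's limit for 1 / Gamma: \<open>rGamma_series z n\<close> contains the Pochhammer
  symbol of length \<open>n + 1\<close>, and its last factor \<open>z + of_nat n\<close> is traded
  for \<open>of_nat n\<close> at no cost in the limit.\<close>

lemma rising_binomial_asymp:
  fixes z :: complex
  shows "(\<lambda>n. rising_binomial z n * of_nat n powr (1 - z)) \<longlonglongrightarrow> rGamma z"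
proof -
  have lim: "(\<lambda>n. rGamma_series z n * (of_nat n / (z + of_nat n))) \<longlonglongrightarrow> rGamma z * 1"
    by (intro tendsto_mult rGamma_series_LIMSEQ of_nat_over_add_tendsto_1)
  have "\<forall>\<^sub>F n in sequentially. rGamma_series z n * (of_nat n / (z + of_nat n)) =
          rising_binomial z n * of_nat n powr (1 - z)"
    \<comment> \<open>Beyond \<open>norm z\<close> the denominator \<open>z + of_nat n\<close>
      cannot vanish.\<close>
    using eventually_gt_at_top[of "nat \<lceil>norm z\<rceil>"]
  proof eventually_elim
    case (elim n)
    hence "real n > norm z" by linarith
    hence nz: "z + of_nat n \<noteq> 0" and n: "n > 0"
      by (metis add.commute add_eq_0_iff norm_minus_cancel norm_of_nat order_less_irrefl,
          metis norm_ge_zero not_less of_nat_0_less_iff order.strict_trans1)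
    have "(of_nat n :: complex) powr (1 - z) = exp (Ln (of_nat n) - z * Ln (of_nat n))"
      using n by (simp add: powr_def algebra_simps)
    also have "\<dots> = of_nat n / exp (z * of_real (ln (of_nat n)))"
      using n exp_Ln[of "of_nat n"] by (simp add: exp_diff Ln_of_nat del: exp_Ln)
    finally have "(of_nat n :: complex) powr (1 - z) = of_nat n / exp (z * of_real (ln (of_nat n)))" .
    thus ?case using nz
      by (simp add: rGamma_series_def rising_binomial_def pochhammer_Suc)
  qed
  thus ?thesis using lim by (simp add: tendsto_cong)
qed

text \<open>Quotient of two growth laws; \<open>Re q > 0\<close> makes the limit of the denominator
  nonzero. If \<open>p\<close> is a pole of Gamma, the limit reads 0 because
  \<open>Gamma p = 0\<close> and division by zero gives 0, in agreement with
  \<open>rGamma p = 0\<close>.\<close>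

lemma rising_binomial_ratio:
  fixes p q :: complex
  assumes "Re q > 0"
  shows "(\<lambda>n. rising_binomial p n / rising_binomial q n * of_nat n powr (q - p)) \<longlonglongrightarrow> Gamma q / Gamma p"
proof -
  have nz: "rGamma q \<noteq> 0"
    using Gamma_nonzero_of_Re_pos[OF assms] by (simp add: Gamma_eq_zero_iff rGamma_eq_zero_iff)
  have "(\<lambda>n. (rising_binomial p n * of_nat n powr (1 - p)) / (rising_binomial q n * of_nat n powr (1 - q)))
          \<longlonglongrightarrow> rGamma p / rGamma q"
    by (intro tendsto_divide rising_binomial_asymp nz)
  moreover have "\<forall>\<^sub>F n in sequentially.
      (rising_binomial p n * of_nat n powr (1 - p)) / (rising_binomial q n * of_nat n powr (1 - q)) =
      rising_binomial p n / rising_binomial q n * of_nat n powr (q - p)"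
    using eventually_gt_at_top[of 0]
  proof eventually_elim
    case (elim n)
    have "(of_nat n :: complex) powr (1 - p) = of_nat n powr (q - p) * of_nat n powr (1 - q)"
      by (simp flip: powr_add)
    thus ?case using elim by simp
  qed
  ultimately show ?thesis by (simp add: tendsto_cong rGamma_inverse_Gamma field_simps)
qed

text \<open>The power of \<open>n\<close> that compares \<open>z\<close> with \<open>Re z\<close>
  has a purely imaginary exponent, hence modulus 1. Estimates can thus be made with positive
  sequences, which Vandermonde sums exactly.\<close>

lemma rising_binomial_norm_ratio:
  fixes z :: complex
  assumes "Re z > 0"
  shows "(\<lambda>n. norm (rising_binomial z n) / rising_binomial (Re z) n) \<longlonglongrightarrow> norm (Gamma (of_real (Re z)) / Gamma z)"
proof -
  have "(\<lambda>n. norm (rising_binomial z n / rising_binomial (of_real (Re z)) n * of_nat n powr (of_real (Re z) - z)))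
          \<longlonglongrightarrow> norm (Gamma (of_real (Re z)) / Gamma z)"
    by (intro tendsto_norm rising_binomial_ratio) (use assms in auto)
  moreover have "\<forall>\<^sub>F n in sequentially.
      norm (rising_binomial z n / rising_binomial (of_real (Re z)) n * of_nat n powr (of_real (Re z) - z)) =
      norm (rising_binomial z n) / rising_binomial (Re z) n"
    using eventually_gt_at_top[of 0]
  proof eventually_elim
    case (elim n)
    have "norm ((of_nat n :: complex) powr (of_real (Re z) - z)) = 1"
      using elim norm_powr_real_powr[of "of_nat n" "of_real (Re z) - z"] by simp
    thus ?case using rising_binomial_pos[OF assms, of n]
      by (simp add: norm_mult norm_divide of_real_rising_binomial)
  qed
  ultimately show ?thesis by (simp add: tendsto_cong)
qed

text \<open>The convergent quotient is bounded, which gives a constant valid for every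
  \<open>n\<close> and not only eventually, as needed to bound whole convolution sums.\<close>

lemma rising_binomial_norm_le:
  fixes z :: complex
  assumes "Re z > 0"
  obtains C where "C > 0" "\<And>n. norm (rising_binomial z n) \<le> C * rising_binomial (Re z) n"
proof -
  have "Bseq (\<lambda>n. norm (rising_binomial z n) / rising_binomial (Re z) n)"
    using rising_binomial_norm_ratio[OF assms] convergentI convergent_imp_Bseq by blast
  then obtain C where C: "C > 0" "\<And>n. norm (norm (rising_binomial z n) / rising_binomial (Re z) n) \<le> C"
    by (auto elim: BseqE)
  show ?thesis
    using C(2) rising_binomial_pos[OF assms] by (intro that[OF C(1)]) (simp add: field_simps abs_of_pos)
qed

text \<open>Gamma has neither zeros nor poles on the right half-plane, so the quotient has a nonzero
  limit and its inverse is bounded too.\<close>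

lemma rising_binomial_norm_ge:
  fixes z :: complex
  assumes "Re z > 0"
  obtains C where "C > 0" "\<And>n. rising_binomial (Re z) n \<le> C * norm (rising_binomial z n)"
proof -
  have nz: "norm (Gamma (of_real (Re z)) / Gamma z) \<noteq> 0"
    using assms Gamma_nonzero_of_Re_pos[of z] Gamma_nonzero_of_Re_pos[of "of_real (Re z)"] by simp
  have "Bseq (\<lambda>n. inverse (norm (rising_binomial z n) / rising_binomial (Re z) n))"
    using tendsto_inverse[OF rising_binomial_norm_ratio[OF assms] nz] convergentI convergent_imp_Bseq by blast
  then obtain C where C: "C > 0" "\<And>n. norm (inverse (norm (rising_binomial z n) / rising_binomial (Re z) n)) \<le> C"
    by (auto elim: BseqE)
  show ?thesis
    using C(2) rising_binomial_pos[OF assms] rising_binomial_nonzero[OF assms]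
    by (intro that[OF C(1)]) (simp add: field_simps abs_of_pos)
qed

lemma rising_binomial_ratio_tendsto_0:
  fixes x y :: real
  assumes "0 < x" "x < y"
  shows "(\<lambda>n. rising_binomial x n / rising_binomial y n) \<longlonglongrightarrow> 0"
proof -
  let ?R = "\<lambda>n. rising_binomial (of_real x :: complex) n / rising_binomial (of_real y) n"
  have "((\<lambda>n. real n powr (x - y)) \<longlongrightarrow> 0) sequentially"
    by (rule tendsto_neg_powr) (use assms filterlim_real_sequentially in auto)
  hence "(\<lambda>n. norm (?R n * of_nat n powr (of_real y - of_real x)) * real n powr (x - y))
          \<longlonglongrightarrow> norm (Gamma (of_real y) / Gamma (of_real x :: complex)) * 0"
    by (intro tendsto_mult tendsto_norm rising_binomial_ratio) (use assms in auto)
  moreover have "\<forall>\<^sub>F n in sequentially.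
      norm (?R n * of_nat n powr (of_real y - of_real x)) * real n powr (x - y) =
      rising_binomial x n / rising_binomial y n"
    using eventually_gt_at_top[of 0]
  proof eventually_elim
    case (elim n)
    have "norm ((of_nat n :: complex) powr (of_real y - of_real x)) = real n powr (y - x)"
      using elim norm_powr_real_powr[of "of_nat n" "of_real y - of_real x"] by simp
    moreover have "real n powr (y - x) * real n powr (x - y) = 1"
      using elim by (simp flip: powr_add)
    ultimately show ?case
      using rising_binomial_pos[of x n] rising_binomial_pos[of y n] assms
      by (simp add: norm_mult norm_divide of_real_rising_binomial)
  qed
  ultimately show ?thesis by (simp add: tendsto_cong)
qed

section \<open>Asymptotics of convolutions and partial sums\<close>

lemma rising_binomial_little_o_bound:
  fixes p :: complex and e :: "nat \<Rightarrow> complex"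
  assumes p: "Re p > 0" and lim: "(\<lambda>m. e m / rising_binomial p m) \<longlonglongrightarrow> 0" and d: "d > 0"
  obtains K where "K \<ge> 0"
    "\<And>m. norm (e m) \<le> d * rising_binomial (Re p) m + K * rising_binomial (Re p / 2) m"
proof -
  have rpos: "rising_binomial (Re p) m > 0" "rising_binomial (Re p / 2) m > 0" for m
    using p by (simp_all add: rising_binomial_pos)
  obtain C where C: "C > 0" "\<And>n. norm (rising_binomial p n) \<le> C * rising_binomial (Re p) n"
    using rising_binomial_norm_le[OF p] by blast
  \<comment> \<open>The tolerance \<open>d / C\<close> makes up for the constant lost in passing
    from \<open>norm (rising_binomial p m)\<close> to
    \<open>rising_binomial (Re p) m\<close>.\<close>
  obtain M where M: "\<And>m. m \<ge> M \<Longrightarrow> norm (e m / rising_binomial p m) < d / C"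
    using tendstoD[OF lim, of "d / C"] d C by (auto simp: eventually_sequentially)
  \<comment> \<open>The sum of the finitely many nonnegative quotients dominates each of
    them.\<close>
  define K where "K = (\<Sum>m<M. norm (e m) / rising_binomial (Re p / 2) m)"
  show ?thesis
  proof (rule that)
    show "K \<ge> 0" unfolding K_def by (intro sum_nonneg divide_nonneg_pos norm_ge_zero rpos)
    fix m
    show "norm (e m) \<le> d * rising_binomial (Re p) m + K * rising_binomial (Re p / 2) m"
    proof (cases "m \<ge> M")
      case True
      have "norm (e m) \<le> d / C * norm (rising_binomial p m)"
        using M[OF True] rising_binomial_nonzero[OF p, of m]
        by (simp add: norm_divide pos_divide_less_eq less_imp_le)
      also have "\<dots> \<le> d / C * (C * rising_binomial (Re p) m)"
        using d C by (intro mult_left_mono C(2)) auto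
      also have "\<dots> = d * rising_binomial (Re p) m" using C by simp
      finally show ?thesis using \<open>K \<ge> 0\<close> rpos(2)[of m] by (simp add: add_increasing2)
    next
      case False
      hence "norm (e m) / rising_binomial (Re p / 2) m \<le> K" unfolding K_def
        by (intro member_le_sum) (auto intro!: divide_nonneg_pos rpos)
      hence "norm (e m) \<le> K * rising_binomial (Re p / 2) m" using rpos(2)[of m] by (simp add: field_simps)
      thus ?thesis using d rpos(1)[of m] by (simp add: add_increasing)
    qed
  qed
qed

text \<open>
  Majorizing the finitely many large terms of \<open>e\<close> by a multiple of \<open>rising_binomial (Re p / 2)\<close> lets
  Vandermonde sum their contribution as well, and it is of lower order.
\<close>

lemma convolution_rising_binomial_bound:
  fixes p q :: complex and e :: "nat \<Rightarrow> complex"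
  assumes p: "Re p > 0" and q: "Re q > 0"
    and lim: "(\<lambda>m. e m / rising_binomial p m) \<longlonglongrightarrow> 0" and d: "d > 0"
  obtains K where "\<And>k. norm (\<Sum>j\<le>k. e (k - j) * rising_binomial q j) \<le>
    d * rising_binomial (Re p + Re q) k + K * rising_binomial (Re p / 2 + Re q) k"
proof -
  obtain C where C: "C > 0" "\<And>n. norm (rising_binomial q n) \<le> C * rising_binomial (Re q) n"
    using rising_binomial_norm_le[OF q] by blast
  obtain K where K: "K \<ge> 0"
    "\<And>m. norm (e m) \<le> d / C * rising_binomial (Re p) m + K * rising_binomial (Re p / 2) m"
    using rising_binomial_little_o_bound[OF p lim, of "d / C"] d C by auto
  have "norm (\<Sum>j\<le>k. e (k - j) * rising_binomial q j) \<le>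
      d * rising_binomial (Re p + Re q) k + (C * K) * rising_binomial (Re p / 2 + Re q) k" for k
  proof -
    have "norm (\<Sum>j\<le>k. e (k - j) * rising_binomial q j) \<le> (\<Sum>j\<le>k. norm (e (k - j)) * norm (rising_binomial q j))"
      by (rule order.trans[OF norm_sum]) (simp add: norm_mult)
    also have "\<dots> \<le> (\<Sum>j\<le>k. (d / C * rising_binomial (Re p) (k - j) + K * rising_binomial (Re p / 2) (k - j)) *
        (C * rising_binomial (Re q) j))"
      using p d C(1) K(1)
      by (intro sum_mono mult_mono K(2) C(2) norm_ge_zero add_nonneg_nonneg mult_nonneg_nonneg)
         (auto intro!: less_imp_le[OF rising_binomial_pos])
    also have "\<dots> = d * rising_binomial (Re p + Re q) k + (C * K) * rising_binomial (Re p / 2 + Re q) k"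
      unfolding rising_binomial_Vandermonde sum_distrib_left sum.distrib[symmetric]
      using C(1) by (intro sum.cong refl) (simp add: field_simps)
    finally show ?thesis .
  qed
  thus ?thesis by (rule that)
qed

text \<open>After division by the rising binomial of \<open>p + q\<close>, the first term of the
  preceding bound is at most a fixed multiple of \<open>d\<close>, and the second tends to 0 because
  \<open>Re p / 2 + Re q < Re p + Re q\<close>.\<close>

lemma convolution_rising_binomial_tendsto_0:
  fixes p q :: complex and e :: "nat \<Rightarrow> complex"
  assumes p: "Re p > 0" and q: "Re q > 0"
    and lim: "(\<lambda>m. e m / rising_binomial p m) \<longlonglongrightarrow> 0"
  shows "(\<lambda>k. (\<Sum>j\<le>k. e (k - j) * rising_binomial q j) / rising_binomial (p + q) k) \<longlonglongrightarrow> 0"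
proof (rule tendstoI)
  fix \<epsilon> :: real assume \<epsilon>: "\<epsilon> > 0"
  have pq: "Re (p + q) > 0" using p q by simp
  obtain C where C: "C > 0" "\<And>n. rising_binomial (Re p + Re q) n \<le> C * norm (rising_binomial (p + q) n)"
    using rising_binomial_norm_ge[OF pq] by auto
  \<comment> \<open>\<open>C\<close> is the price of returning to the complex parameter
    \<open>p + q\<close>. The factor 2 leaves half of \<open>\<epsilon> / C\<close> for the
    lower-order term.\<close>
  obtain K where K: "\<And>k. norm (\<Sum>j\<le>k. e (k - j) * rising_binomial q j) \<le>
      \<epsilon> / (2 * C) * rising_binomial (Re p + Re q) k + K * rising_binomial (Re p / 2 + Re q) k"
    using convolution_rising_binomial_bound[OF p q lim, of "\<epsilon> / (2 * C)"] \<epsilon> C(1) by auto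
  have "(\<lambda>k. \<epsilon> / (2 * C) + K * (rising_binomial (Re p / 2 + Re q) k / rising_binomial (Re p + Re q) k))
      \<longlonglongrightarrow> \<epsilon> / (2 * C) + K * 0"
    by (intro tendsto_intros rising_binomial_ratio_tendsto_0) (use p q in auto)
  moreover have "\<epsilon> / (2 * C) + K * 0 < \<epsilon> / C" using \<epsilon> C by (simp add: field_simps)
  ultimately have "\<forall>\<^sub>F k in sequentially.
      \<epsilon> / (2 * C) + K * (rising_binomial (Re p / 2 + Re q) k / rising_binomial (Re p + Re q) k) < \<epsilon> / C"
    by (rule order_tendstoD)
  thus "\<forall>\<^sub>F k in sequentially.
      dist ((\<Sum>j\<le>k. e (k - j) * rising_binomial q j) / rising_binomial (p + q) k) 0 < \<epsilon>"
  proof eventually_elim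
    case (elim k)
    let ?R = "rising_binomial (Re p + Re q) k"
    have R: "?R > 0" using p q by (simp add: rising_binomial_pos)
    have "norm (\<Sum>j\<le>k. e (k - j) * rising_binomial q j) \<le>
        \<epsilon> / (2 * C) * ?R + K * rising_binomial (Re p / 2 + Re q) k"
      by (rule K)
    also have "\<dots> = ?R * (\<epsilon> / (2 * C) + K * (rising_binomial (Re p / 2 + Re q) k / ?R))"
      using R by (simp add: distrib_left mult.left_commute[of ?R])
    also have "\<dots> < ?R * (\<epsilon> / C)" using elim R by (intro mult_strict_left_mono)
    also have "\<dots> \<le> (C * norm (rising_binomial (p + q) k)) * (\<epsilon> / C)"
      using C \<epsilon> by (intro mult_right_mono) auto
    finally show ?case
      using rising_binomial_nonzero[OF pq, of k] C(1) by (simp add: norm_divide divide_less_eq mult.commute)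
  qed
qed

text \<open>Subtracting \<open>L * rising_binomial p m\<close> reduces to limit 0, since by
  Vandermonde the convolution of the subtracted sequence is exactly
  \<open>L * rising_binomial (p + q) k\<close>.\<close>

lemma convolution_rising_binomial_asymp:
  fixes p q L :: complex
  assumes p: "Re p > 0" and q: "Re q > 0"
    and lim: "(\<lambda>m. a m / rising_binomial p m) \<longlonglongrightarrow> L"
  shows "(\<lambda>k. (\<Sum>j\<le>k. a (k - j) * rising_binomial q j) / rising_binomial (p + q) k) \<longlonglongrightarrow> L"
proof -
  let ?e = "\<lambda>m. a m - L * rising_binomial p m"
  have "(\<lambda>m. ?e m / rising_binomial p m) \<longlonglongrightarrow> 0"
    using tendsto_diff[OF lim tendsto_const[of L]] rising_binomial_nonzero[OF p]
    by (simp add: diff_divide_distrib)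
  hence "(\<lambda>k. (\<Sum>j\<le>k. ?e (k - j) * rising_binomial q j) / rising_binomial (p + q) k) \<longlonglongrightarrow> 0"
    by (rule convolution_rising_binomial_tendsto_0[OF p q])
  moreover have "(\<Sum>j\<le>k. ?e (k - j) * rising_binomial q j) =
      (\<Sum>j\<le>k. a (k - j) * rising_binomial q j) - L * rising_binomial (p + q) k" for k
    unfolding rising_binomial_Vandermonde sum_distrib_left sum_subtractf[symmetric]
    by (simp add: algebra_simps)
  moreover have "rising_binomial (p + q) k \<noteq> 0" for k
    using p q by (simp add: rising_binomial_nonzero)
  ultimately show ?thesis
    by (simp add: diff_divide_distrib flip: LIM_zero_iff[of _ L])
qed

text \<open>Partial sums are convolutions with the constant sequence
  \<open>rising_binomial 1\<close>, so the parameter grows from \<open>s\<close> to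
  \<open>s + 1\<close>.\<close>

lemma partial_sum_rising_binomial_asymp:
  fixes s L :: complex
  assumes s: "Re s > 0" and lim: "(\<lambda>k. b k / rising_binomial s k) \<longlonglongrightarrow> L"
  shows "(\<lambda>N. of_nat N powr (- s) * (\<Sum>k<N. b k)) \<longlonglongrightarrow> L / Gamma (s + 1)"
proof -
  have "(\<lambda>k. (\<Sum>j\<le>k. b (k - j) * rising_binomial 1 j) / rising_binomial (s + 1) k) \<longlonglongrightarrow> L"
    by (rule convolution_rising_binomial_asymp) (use assms in auto)
  hence "(\<lambda>k. (\<Sum>j\<le>k. b (k - j)) / rising_binomial (s + 1) k) \<longlonglongrightarrow> L" by simp
  moreover have "(\<Sum>j\<le>k. b (k - j)) = (\<Sum>j<Suc k. b j)" for k
    by (rule sum.reindex_bij_witness[of _ "\<lambda>j. k - j" "\<lambda>j. k - j"]) auto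
  \<comment> \<open>The sum over \<open>j \<le> k\<close> has \<open>N = Suc k\<close> terms, but
    its denominator has index \<open>k\<close>. The quotient of the rising binomials at
    \<open>k\<close> and \<open>Suc k\<close> is \<open>Suc k / (s + Suc k)\<close>, which tends to
    1.\<close>
  ultimately have "(\<lambda>k. (\<Sum>j<Suc k. b j) / rising_binomial (s + 1) k *
      ((rising_binomial (s + 1) (Suc k) * of_nat (Suc k) powr (1 - (s + 1))) *
       (of_nat (Suc k) / (s + of_nat (Suc k))))) \<longlonglongrightarrow> L * (rGamma (s + 1) * 1)"
    by (intro tendsto_mult LIMSEQ_Suc[OF rising_binomial_asymp] LIMSEQ_Suc[OF of_nat_over_add_tendsto_1]) simp
  moreover have "(\<Sum>j<Suc k. b j) / rising_binomial (s + 1) k *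
      ((rising_binomial (s + 1) (Suc k) * of_nat (Suc k) powr (1 - (s + 1))) *
       (of_nat (Suc k) / (s + of_nat (Suc k)))) = of_nat (Suc k) powr (- s) * (\<Sum>j<Suc k. b j)" for k
  proof -
    have nz: "s + of_nat (Suc k) \<noteq> 0" using s by (auto simp: complex_eq_iff)
    have "rising_binomial (s + 1) (Suc k) * of_nat (Suc k) / (s + of_nat (Suc k)) = rising_binomial (s + 1) k"
      using nz by (simp add: rising_binomial_def pochhammer_Suc add_ac divide_simps del: of_nat_Suc)
         (simp add: algebra_simps)
    moreover have "rising_binomial (s + 1) (Suc k) * of_nat (Suc k) powr (1 - (s + 1)) * (of_nat (Suc k) / (s + of_nat (Suc k))) =
       rising_binomial (s + 1) (Suc k) * of_nat (Suc k) / (s + of_nat (Suc k)) * of_nat (Suc k) powr (- s)"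
      by (simp add: mult_ac del: of_nat_Suc)
    ultimately have "rising_binomial (s + 1) (Suc k) * of_nat (Suc k) powr (1 - (s + 1)) * (of_nat (Suc k) / (s + of_nat (Suc k))) =
       rising_binomial (s + 1) k * of_nat (Suc k) powr (- s)"
      by (simp only:)
    thus ?thesis using rising_binomial_nonzero[of "s + 1" k] s
      by (simp only:) (simp add: mult_ac del: of_nat_Suc sum.lessThan_Suc)
  qed
  ultimately have "(\<lambda>k. of_nat (Suc k) powr (- s) * (\<Sum>j<Suc k. b j)) \<longlonglongrightarrow> L * (rGamma (s + 1) * 1)"
    by (simp only:)
  moreover have "L * (rGamma (s + 1) * 1) = L / Gamma (s + 1)"
    by (simp add: rGamma_inverse_Gamma divide_inverse)
  ultimately have "(\<lambda>k. of_nat (Suc k) powr (- s) * (\<Sum>j<Suc k. b j)) \<longlonglongrightarrow> L / Gamma (s + 1)"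
    by (simp only:)
  thus ?thesis by (simp only: filterlim_sequentially_Suc[where f = "\<lambda>N. of_nat N powr (- s) * (\<Sum>k<N. b k)"])
qed

text \<open>Both sequences grow like m^(2s - 2). The assumption puts \<open>2 * s - 1\<close> in the
  right half-plane, where 1 / Gamma does not vanish.\<close>

lemma rising_binomial_square_ratio:
  fixes s :: complex
  assumes "1 / 2 < Re s"
  shows "(\<lambda>m. (rising_binomial s m)\<^sup>2 / rising_binomial (2 * s - 1) m) \<longlonglongrightarrow> Gamma (2 * s - 1) / (Gamma s)\<^sup>2"
proof -
  have nz: "rGamma (2 * s - 1) \<noteq> 0"
    using Gamma_nonzero_of_Re_pos[of "2 * s - 1"] assms by (simp add: Gamma_eq_zero_iff rGamma_eq_zero_iff)
  have "(\<lambda>m. (rising_binomial s m * of_nat m powr (1 - s))\<^sup>2 /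
      (rising_binomial (2 * s - 1) m * of_nat m powr (1 - (2 * s - 1)))) \<longlonglongrightarrow> (rGamma s)\<^sup>2 / rGamma (2 * s - 1)"
    by (intro tendsto_intros rising_binomial_asymp nz)
  moreover have "\<forall>\<^sub>F m in sequentially. (rising_binomial s m * of_nat m powr (1 - s))\<^sup>2 /
      (rising_binomial (2 * s - 1) m * of_nat m powr (1 - (2 * s - 1))) =
      (rising_binomial s m)\<^sup>2 / rising_binomial (2 * s - 1) m"
    using eventually_gt_at_top[of 0]
  proof eventually_elim
    case (elim m)
    have "(of_nat m :: complex) powr (1 - (2 * s - 1)) = (of_nat m powr (1 - s))\<^sup>2"
      by (simp add: power2_eq_square flip: powr_add)
    thus ?case using elim by (simp add: power_mult_distrib)
  qed
  ultimately show ?thesis by (simp add: tendsto_cong rGamma_inverse_Gamma field_simps)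
qed

section \<open>Gamma integrals with a complex exponent\<close>

text \<open>The integrand of the Gamma integral of \<open>a + 1\<close>, extended by 0. The exponent
  is complex because it will be \<alpha> - s.\<close>

definition gamma_weight :: "complex \<Rightarrow> real \<Rightarrow> complex" where
  "gamma_weight a x = indicator {0<..} x *\<^sub>R (of_real x powr a / of_real (exp x))"

text \<open>The principal logarithm has imaginary part \<open>pi\<close> on the negative axis, so a
  distinction by sign turns the power into a composition of measurable functions.\<close>

lemma borel_measurable_of_real_powr [measurable]:
  "(\<lambda>x. complex_of_real x powr z) \<in> borel_measurable borel"
proof -
  have "complex_of_real x powr z = (if x = 0 then 0 else
      exp (z * (of_real (ln \<bar>x\<bar>) + (if x < 0 then \<i> * of_real pi else 0))))" for x
    using Ln_minus[of "of_real (- x)"] Ln_of_real[of "- x"] by (cases x "0 :: real" rule: linorder_cases) (auto simp: powr_def Ln_of_real)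
  moreover have "(\<lambda>x. if x = 0 then 0 else
      exp (z * (of_real (ln \<bar>x\<bar>) + (if x < 0 then \<i> * of_real pi else 0)))) \<in> borel_measurable borel"
    by measurable
  ultimately show ?thesis by (simp cong: measurable_cong)
qed

text \<open>The known facts on the Gamma integral concern \<open>lebesgue\<close> and the gauge
  integral; Borel measurability of the weight carries both over to \<open>lborel\<close>.\<close>

lemma has_bochner_integral_gamma_weight:
  assumes "Re a > -1"
  shows "has_bochner_integral lborel (gamma_weight a) (Gamma (a + 1))"
proof -
  have meas: "gamma_weight a \<in> borel_measurable lborel"
    unfolding gamma_weight_def by simp
  have pos: "Re (a + 1) > 0" using assms by simp
  have "integrable lebesgue (gamma_weight a)"
    using absolutely_integrable_Gamma_integral'[OF pos]
    unfolding set_integrable_def gamma_weight_def by simp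
  hence int: "integrable lborel (gamma_weight a)"
    using meas by (simp add: integrable_completion)
  hence "set_integrable lborel {0<..} (\<lambda>x. of_real x powr a / of_real (exp x))"
    unfolding set_integrable_def gamma_weight_def .
  hence "(LINT x : {0<..} | lborel. of_real x powr a / of_real (exp x)) =
      integral {0<..} (\<lambda>x. complex_of_real x powr a / of_real (exp x))"
    by (rule set_borel_integral_eq_integral)
  also have "\<dots> = Gamma (a + 1)"
    using Gamma_integral_complex'[OF pos] by (intro integral_unique) simp
  finally have "integral\<^sup>L lborel (gamma_weight a) = Gamma (a + 1)"
    by (simp add: set_lebesgue_integral_def gamma_weight_def[abs_def])
  with int show ?thesis by (simp add: has_bochner_integral_iff)
qed

lemma has_bochner_integral_gamma_weight_power:
  assumes "Re a > -1"
  shows "has_bochner_integral lborel (\<lambda>x. gamma_weight a x * of_real x ^ m) (Gamma (a + 1 + of_nat m))"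
proof -
  have "gamma_weight (a + of_nat m) x = gamma_weight a x * of_real x ^ m" for x
    by (cases "x > 0") (auto simp: gamma_weight_def powr_add powr_nat)
  hence "gamma_weight (a + of_nat m) = (\<lambda>x. gamma_weight a x * of_real x ^ m)" by (rule ext)
  thus ?thesis using has_bochner_integral_gamma_weight[of "a + of_nat m"] assms
    by (simp add: add_ac)
qed

lemma has_bochner_integral_gamma_weight_poly:
  assumes "Re a > -1"
  shows "has_bochner_integral lborel (\<lambda>x. gamma_weight a x * poly P (of_real x))
           (\<Sum>i\<le>degree P. coeff P i * Gamma (a + 1 + of_nat i))"
proof -
  have "has_bochner_integral lborel (\<lambda>x. \<Sum>i\<le>degree P. coeff P i * (gamma_weight a x * of_real x ^ i))
           (\<Sum>i\<le>degree P. coeff P i * Gamma (a + 1 + of_nat i))"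
    by (intro has_bochner_integral_sum has_bochner_integral_mult_right has_bochner_integral_gamma_weight_power assms)
  thus ?thesis
    by (simp add: poly_altdef sum_distrib_left mult.left_commute)
qed

lemma integrable_gamma_weight_poly:
  "Re a > -1 \<Longrightarrow> integrable lborel (\<lambda>x. gamma_weight a x * poly P (of_real x))"
  using has_bochner_integral_gamma_weight_poly has_bochner_integral_iff by blast

section \<open>Laguerre polynomials with complex parameter\<close>

text \<open>
  The coefficient of \<open>x\<^sup>i\<close> is \<open>(-1)\<^sup>i / i!\<close> times the generalized binomial coefficient of \<open>k + a\<close> over
  \<open>k - i\<close>, written as a rising binomial so that Vandermonde convolution in \<open>a\<close> applies directly.
\<close>

definition laguerre_poly :: "complex \<Rightarrow> nat \<Rightarrow> complex poly" where
  "laguerre_poly a k = (\<Sum>i\<le>k. Polynomial.monom ((-1) ^ i / fact i * rising_binomial (a + 1 + of_nat i) (k - i)) i)"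

lemma coeff_laguerre_poly:
  "coeff (laguerre_poly a k) i = (if i \<le> k then (-1) ^ i / fact i * rising_binomial (a + 1 + of_nat i) (k - i) else 0)"
  unfolding laguerre_poly_def by (simp add: coeff_sum if_distrib cong: if_cong)

lemma degree_laguerre_poly_le: "degree (laguerre_poly a k) \<le> k"
  by (rule degree_le) (simp add: coeff_laguerre_poly)

text \<open>In each coefficient this is Vandermonde for the splitting of \<open>b + 1 + i\<close>
  into \<open>b - a\<close> and \<open>a + 1 + i\<close>.\<close>

lemma laguerre_poly_connection:
  "laguerre_poly b k = (\<Sum>j\<le>k. Polynomial.smult (rising_binomial (b - a) (k - j)) (laguerre_poly a j))"
proof (rule poly_eqI)
  fix i
  show "coeff (laguerre_poly b k) i = coeff (\<Sum>j\<le>k. Polynomial.smult (rising_binomial (b - a) (k - j)) (laguerre_poly a j)) i"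
  proof (cases "i \<le> k")
    case True
    have "rising_binomial (b + 1 + of_nat i) (k - i) = rising_binomial ((b - a) + (a + 1 + of_nat i)) (k - i)"
      by (simp add: add.assoc)
    also have "\<dots> = (\<Sum>j\<le>k - i. rising_binomial (b - a) (k - i - j) * rising_binomial (a + 1 + of_nat i) j)"
      by (rule rising_binomial_Vandermonde)
    also have "\<dots> = (\<Sum>j\<in>{i..k}. rising_binomial (b - a) (k - j) * rising_binomial (a + 1 + of_nat i) (j - i))"
      using True by (intro sum.reindex_bij_witness[of _ "\<lambda>j. j - i" "\<lambda>j. j + i"]) (auto simp: add.commute)
    finally have "coeff (laguerre_poly b k) i =
        (\<Sum>j\<in>{i..k}. rising_binomial (b - a) (k - j) * coeff (laguerre_poly a j) i)"
      using True by (simp add: coeff_laguerre_poly sum_distrib_left mult.left_commute)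
    also have "\<dots> = (\<Sum>j\<le>k. rising_binomial (b - a) (k - j) * coeff (laguerre_poly a j) i)"
      by (intro sum.mono_neutral_left) (auto simp: coeff_laguerre_poly)
    finally show ?thesis by (simp add: coeff_sum)
  qed (auto simp: coeff_laguerre_poly coeff_sum)
qed

text \<open>Termwise integration gives a sum of Gamma values which, after a reflection, is a
  Vandermonde convolution. The closed form exposes the vanishing for \<open>m < k\<close>.\<close>

lemma integral_laguerre_poly_power:
  assumes "Re a > -1"
  shows "(\<integral>x. gamma_weight a x * poly (laguerre_poly a k * Polynomial.monom 1 m) (of_real x) \<partial>lborel) =
           (-1) ^ k * Gamma (a + 1 + of_nat m) * rising_binomial (of_nat m + 1 - of_nat k) k"
proof -
  have pos: "a + 1 + of_nat m \<notin> \<int>\<^sub>\<le>\<^sub>0"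
    using assms by (auto elim!: nonpos_Ints_cases simp: complex_eq_iff)
  have G: "Gamma (a + 1 + of_nat m + of_nat i) = Gamma (a + 1 + of_nat m) * pochhammer (a + 1 + of_nat m) i" for i
    using pochhammer_Gamma[OF pos, of i] pos by (simp add: Gamma_eq_zero_iff)
  have "(\<integral>x. gamma_weight a x * poly (laguerre_poly a k * Polynomial.monom 1 m) (of_real x) \<partial>lborel) =
      (\<integral>x. (\<Sum>i\<le>k. coeff (laguerre_poly a k) i * (gamma_weight a x * of_real x ^ (m + i))) \<partial>lborel)"
    by (intro Bochner_Integration.integral_cong refl)
       (simp add: laguerre_poly_def poly_sum poly_monom coeff_sum if_distrib sum_distrib_left sum_distrib_right
          power_add mult_ac cong: if_cong)
  also have "\<dots> = (\<Sum>i\<le>k. coeff (laguerre_poly a k) i * Gamma (a + 1 + of_nat (m + i)))"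
    by (intro has_bochner_integral_integral_eq has_bochner_integral_sum has_bochner_integral_mult_right
          has_bochner_integral_gamma_weight_power assms)
  also have "\<dots> = (\<Sum>i\<le>k. (-1) ^ k * Gamma (a + 1 + of_nat m) *
                   (rising_binomial (- (a + of_nat k)) (k - i) * rising_binomial (a + 1 + of_nat m) i))"
  proof (intro sum.cong refl)
    fix i assume "i \<in> {..k}"
    hence i: "i \<le> k" by simp
    \<comment> \<open>Reflection removes \<open>i\<close> from the parameter, so that the sum over
      \<open>i\<close> becomes a genuine convolution.\<close>
    have R: "rising_binomial (- (a + of_nat k)) (k - i) = (-1) ^ (k - i) * rising_binomial (a + 1 + of_nat i) (k - i)"
      using i by (subst rising_binomial_minus, simp add: of_nat_diff add_ac)
    have "(-1) ^ k = (-1) ^ i * ((-1) ^ (k - i) :: complex)"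
      using i by (simp flip: power_add)
    hence sgn: "(-1) ^ k * (-1) ^ (k - i) = ((-1) ^ i :: complex)"
      by (simp add: mult.assoc flip: power_mult_distrib)
    have "coeff (laguerre_poly a k) i * Gamma (a + 1 + of_nat (m + i)) =
       (-1) ^ i * rising_binomial (a + 1 + of_nat i) (k - i) * (Gamma (a + 1 + of_nat m) * rising_binomial (a + 1 + of_nat m) i)"
      using i G[of i] by (simp add: coeff_laguerre_poly rising_binomial_def add.assoc)
    also have "\<dots> = (-1) ^ k * Gamma (a + 1 + of_nat m) *
                   (rising_binomial (- (a + of_nat k)) (k - i) * rising_binomial (a + 1 + of_nat m) i)"
      unfolding R sgn[symmetric] by (simp only: mult_ac)
    finally show "coeff (laguerre_poly a k) i * Gamma (a + 1 + of_nat (m + i)) = \<dots>" .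
  qed
  also have "\<dots> = (-1) ^ k * Gamma (a + 1 + of_nat m) * rising_binomial (- (a + of_nat k) + (a + 1 + of_nat m)) k"
    unfolding rising_binomial_Vandermonde[of "- (a + of_nat k)" "a + 1 + of_nat m" k]
    by (simp only: sum_distrib_left)
  also have "- (a + of_nat k) + (a + 1 + of_nat m) = of_nat m + 1 - of_nat k" by simp
  finally show ?thesis .
qed

text \<open>Powers below \<open>k\<close> integrate to 0, and for \<open>m = k\<close> the last
  factor is \<open>rising_binomial 1 k = 1\<close>.\<close>

lemma integral_laguerre_poly_mult:
  assumes a: "Re a > -1" and Q: "degree Q \<le> k"
  shows "(\<integral>x. gamma_weight a x * poly (laguerre_poly a k * Q) (of_real x) \<partial>lborel) =
           (-1) ^ k * coeff Q k * Gamma (a + 1 + of_nat k)"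
proof -
  have "(\<integral>x. gamma_weight a x * poly (laguerre_poly a k * Q) (of_real x) \<partial>lborel) =
     (\<integral>x. (\<Sum>m\<le>k. coeff Q m * (gamma_weight a x * poly (laguerre_poly a k * Polynomial.monom 1 m) (of_real x))) \<partial>lborel)"
  proof (intro Bochner_Integration.integral_cong refl)
    fix x :: real
    have "poly Q (of_real x) = (\<Sum>m\<le>k. coeff Q m * of_real x ^ m)"
      unfolding poly_altdef using Q by (intro sum.mono_neutral_left) (auto simp: coeff_eq_0)
    thus "gamma_weight a x * poly (laguerre_poly a k * Q) (of_real x) =
       (\<Sum>m\<le>k. coeff Q m * (gamma_weight a x * poly (laguerre_poly a k * Polynomial.monom 1 m) (of_real x)))"
      by (simp add: poly_monom sum_distrib_left mult_ac)
  qed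
  also have "\<dots> = (\<Sum>m\<le>k. coeff Q m * ((-1) ^ k * Gamma (a + 1 + of_nat m) * rising_binomial (of_nat m + 1 - of_nat k) k))"
    using a by (simp add: integral_laguerre_poly_power integrable_gamma_weight_poly del: poly_mult)
  also have "\<dots> = (\<Sum>m\<le>k. if m = k then (-1) ^ k * coeff Q k * Gamma (a + 1 + of_nat k) else 0)"
  proof (intro sum.cong refl)
    fix m assume "m \<in> {..k}"
    hence m: "m \<le> k" by simp
    show "coeff Q m * ((-1) ^ k * Gamma (a + 1 + of_nat m) * rising_binomial (of_nat m + 1 - of_nat k) k) =
       (if m = k then (-1) ^ k * coeff Q k * Gamma (a + 1 + of_nat k) else 0)"
    proof (cases "m = k")
      case False
      \<comment> \<open>Here \<open>m < k\<close>, so the natural subtraction is exact, and the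
        Pochhammer symbol of length \<open>k\<close> starting at \<open>-(k - 1 - m)\<close> runs
        through 0.\<close>
      hence "of_nat m + 1 - of_nat k = - (of_nat (k - 1 - m) :: complex)"
        using m by (simp add: of_nat_diff)
      moreover have "pochhammer (- (of_nat (k - 1 - m) :: complex)) k = 0"
        using False m by (intro pochhammer_of_nat_eq_0_lemma) simp
      ultimately have "rising_binomial (of_nat m + 1 - of_nat k :: complex) k = 0"
        by (simp add: rising_binomial_def)
      thus ?thesis using False by simp
    qed simp
  qed
  also have "\<dots> = (-1) ^ k * coeff Q k * Gamma (a + 1 + of_nat k)" by simp
  finally show ?thesis .
qed

text \<open>The pairing is bilinear, without conjugation, so that it persists for complex
  \<open>a\<close>. On the diagonal the leading coefficient (-1)^k / k! cancels the sign and turns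
  the Pochhammer symbol into a rising binomial.\<close>

lemma laguerre_poly_orthogonal:
  assumes a: "Re a > -1"
  shows "(\<integral>x. gamma_weight a x * (poly (laguerre_poly a j) (of_real x) * poly (laguerre_poly a k) (of_real x)) \<partial>lborel) =
           (if j = k then Gamma (a + 1) * rising_binomial (a + 1) k else 0)"
proof -
  have less: "(\<integral>x. gamma_weight a x * (poly (laguerre_poly a i) (of_real x) * poly (laguerre_poly a k) (of_real x)) \<partial>lborel) = 0"
    if "i < k" for i k
    using integral_laguerre_poly_mult[OF a, of "laguerre_poly a i" k] that degree_laguerre_poly_le[of a i]
    by (simp add: coeff_laguerre_poly mult.commute mult.left_commute)
  have pos: "a + 1 \<notin> \<int>\<^sub>\<le>\<^sub>0"
    using assms by (auto elim!: nonpos_Ints_cases simp: complex_eq_iff)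
  have "Gamma (a + 1 + of_nat k) = Gamma (a + 1) * pochhammer (a + 1) k"
    using pochhammer_Gamma[OF pos, of k] pos by (simp add: Gamma_eq_zero_iff)
  hence eq: "(\<integral>x. gamma_weight a x * (poly (laguerre_poly a k) (of_real x) * poly (laguerre_poly a k) (of_real x)) \<partial>lborel) =
     Gamma (a + 1) * rising_binomial (a + 1) k"
    using integral_laguerre_poly_mult[OF a, of "laguerre_poly a k" k] degree_laguerre_poly_le[of a k]
    by (simp add: coeff_laguerre_poly rising_binomial_def)
  consider "j < k" | "j = k" | "k < j" by linarith
  thus ?thesis using less[of j k] less[of k j] eq by cases (simp_all add: mult.commute)
qed

text \<open>The connection formula passes to the family orthogonal for the weight at hand, so no
  cross terms remain. It is applied with \<open>b - a = s\<close>.\<close>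

lemma integral_laguerre_poly_square:
  assumes a: "Re a > -1"
  shows "(\<integral>x. gamma_weight a x * (poly (laguerre_poly b k) (of_real x))\<^sup>2 \<partial>lborel) =
           Gamma (a + 1) * (\<Sum>j\<le>k. (rising_binomial (b - a) (k - j))\<^sup>2 * rising_binomial (a + 1) j)"
proof -
  let ?L = "\<lambda>j x. poly (laguerre_poly a j) (complex_of_real x)"
  let ?r = "\<lambda>j. rising_binomial (b - a) (k - j)"
  have int: "integrable lborel (\<lambda>x. gamma_weight a x * (?L i x * ?L j x))" for i j
    using integrable_gamma_weight_poly[OF a, of "laguerre_poly a i * laguerre_poly a j"] by simp
  have "(\<integral>x. gamma_weight a x * (poly (laguerre_poly b k) (of_real x))\<^sup>2 \<partial>lborel) =
      (\<integral>x. (\<Sum>i\<le>k. \<Sum>j\<le>k. (?r i * ?r j) * (gamma_weight a x * (?L i x * ?L j x))) \<partial>lborel)"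
    by (intro Bochner_Integration.integral_cong refl, subst laguerre_poly_connection[of b k a])
       (simp add: poly_sum power2_eq_square sum_product sum_distrib_left mult_ac)
  also have "\<dots> = (\<Sum>i\<le>k. \<Sum>j\<le>k. (?r i * ?r j) * (\<integral>x. gamma_weight a x * (?L i x * ?L j x) \<partial>lborel))"
    by (simp add: int)
  also have "\<dots> = (\<Sum>i\<le>k. \<Sum>j\<le>k. if i = j then (?r i)\<^sup>2 * (Gamma (a + 1) * rising_binomial (a + 1) i) else 0)"
    by (intro sum.cong refl) (simp add: laguerre_poly_orthogonal[OF a] power2_eq_square)
  also have "\<dots> = Gamma (a + 1) * (\<Sum>j\<le>k. (?r j)\<^sup>2 * rising_binomial (a + 1) j)"
    by (simp add: sum_distrib_left mult_ac)
  finally show ?thesis .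
qed

section \<open>Vandermonde determinants of polynomials\<close>

text \<open>One linear factor is split off per root. Using \<open>coeff P n\<close> instead of the
  leading coefficient includes a drop in degree: \<open>n\<close> distinct roots then force
  \<open>P = 0\<close>.\<close>

lemma poly_eq_prod_roots:
  fixes P :: "'a::idom poly"
  assumes "degree P \<le> n" "inj_on x {..<n}" "\<And>i. i < n \<Longrightarrow> poly P (x i) = 0"
  shows "poly P t = coeff P n * (\<Prod>i<n. (t - x i))"
  using assms
proof (induction n arbitrary: P)
  case 0
  thus ?case by (auto elim!: degree_eq_zeroE)
next
  case (Suc n)
  have "poly P (x n) = 0" using Suc.prems by simp
  then obtain Q where Q: "P = [:- x n, 1:] * Q" by (auto simp: poly_eq_0_iff_dvd)
  have degQ: "degree Q \<le> n"
    using Suc.prems(1) degree_mult_eq[of "[:- x n, 1:]" Q] by (cases "Q = 0") (auto simp: Q simp del: mult_pCons_left)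
  have "poly Q (x i) = 0" if "i < n" for i
  proof -
    have "x i \<noteq> x n" using Suc.prems(2) that by (auto simp: inj_on_def)
    thus ?thesis using Suc.prems(3)[of i] that by (simp add: Q)
  qed
  hence "poly Q t = coeff Q n * (\<Prod>i<n. (t - x i))"
    using Suc.prems(2) by (intro Suc.IH degQ) (auto simp: inj_on_def)
  moreover have "coeff P (Suc n) = coeff Q n"
    using degQ by (simp add: Q coeff_eq_0)
  moreover have "poly P t = (t - x n) * poly Q t" by (simp add: Q algebra_simps)
  ultimately show ?case by (simp add: mult_ac)
qed

text \<open>Induction on \<open>n\<close>: with a variable \<open>t\<close> in the last row, the
  determinant is a polynomial in \<open>t\<close> of degree at most \<open>n\<close> that vanishes
  at the earlier nodes, and its coefficient at \<open>n\<close> comes from the smaller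
  determinant.\<close>

lemma det_poly_Vandermonde:
  fixes p :: "nat \<Rightarrow> 'a::idom poly" and x :: "nat \<Rightarrow> 'a"
  assumes deg: "\<And>k. degree (p k) \<le> k"
  shows "Determinant.det (Matrix.mat n n (\<lambda>(i, j). poly (p j) (x i))) =
           (\<Prod>k<n. coeff (p k) k) * (\<Prod>j<n. \<Prod>i<j. (x j - x i))"
proof (induction n)
  case 0
  show ?case by (simp add: Determinant.det_def)
next
  case (Suc n)
  define A where "A t = Matrix.mat (Suc n) (Suc n) (\<lambda>(i, j). poly (p j) (if i = n then t else x i))" for t
  have A: "A t \<in> carrier_mat (Suc n) (Suc n)" for t by (simp add: A_def)
  define c where "c j = cofactor (A 0) n j" for j
  define P where "P = (\<Sum>j<Suc n. Polynomial.smult (c j) (p j))"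
  \<comment> \<open>Cofactors along the last row delete that row and hence do not depend on
    \<open>t\<close>.\<close>
  have "cofactor (A t) n j = c j" for t j
  proof -
    have "mat_delete (A t) n j = mat_delete (A 0) n j"
      by (rule eq_matI) (auto simp: mat_delete_def A_def)
    thus ?thesis by (simp add: c_def cofactor_def)
  qed
  hence P: "Determinant.det (A t) = poly P t" for t
    by (subst laplace_expansion_row[OF A, of n])
       (auto simp: P_def poly_sum A_def mult.commute intro!: sum.cong)
  have "mat_delete (A 0) n n = Matrix.mat n n (\<lambda>(i, j). poly (p j) (x i))"
    by (rule eq_matI) (auto simp: mat_delete_def A_def)
  hence cn: "c n = Determinant.det (Matrix.mat n n (\<lambda>(i, j). poly (p j) (x i)))"
    by (simp add: c_def cofactor_def flip: mult_2)
  have degP: "degree P \<le> n"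
    unfolding P_def by (intro degree_sum_le) (auto intro: order.trans[OF degree_smult_le] order.trans[OF deg])
  have "coeff P n = c n * coeff (p n) n"
    using le_less_trans[OF deg] by (auto simp: P_def coeff_sum intro!: sum.neutral coeff_eq_0)
  moreover have "poly P (x n) = coeff P n * (\<Prod>i<n. (x n - x i))"
  proof (cases "inj_on x {..<n}")
    case True
    have "poly P (x i) = 0" if "i < n" for i
    proof -
      have "Determinant.det (A (x i)) = 0"
        using that by (intro det_identical_rows[OF A, of i n]) (auto simp: A_def)
      thus ?thesis by (simp add: P)
    qed
    thus ?thesis using True degP by (intro poly_eq_prod_roots)
  next
    \<comment> \<open>Two equal nodes give equal rows in both the large and the small determinant,
      so both sides are 0.\<close>
    case False
    then obtain i j where ij: "i < n" "j < n" "i \<noteq> j" "x i = x j"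
      by (auto simp: inj_on_def)
    have "Determinant.det (A t) = 0" for t
      using ij by (intro det_identical_rows[OF A, of i j]) (auto simp: A_def)
    moreover have "Determinant.det (Matrix.mat n n (\<lambda>(i, j). poly (p j) (x i))) = 0"
      using ij by (intro det_identical_rows[of _ n i j]) (auto simp: Matrix.row_def)
    ultimately show ?thesis using \<open>coeff P n = c n * coeff (p n) n\<close> by (simp add: cn flip: P)
  qed
  moreover have "A (x n) = Matrix.mat (Suc n) (Suc n) (\<lambda>(i, j). poly (p j) (x i))"
    by (rule eq_matI) (auto simp: A_def)
  ultimately show ?case
    using P[of "x n"] Suc.IH by (simp add: cn mult_ac)
qed

section \<open>Integrals of squared determinants and sums over permutations\<close>

text \<open>The preimage of \<open>p j\<close> under \<open>q\<close> must be \<open>j\<close>: at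
  any other place \<open>p\<close> and \<open>q\<close> agree, so \<open>p\<close> would take the
  value \<open>p j\<close> twice.\<close>

lemma permutes_eq_of_agree_except:
  assumes "p permutes S" "q permutes S" "\<And>i. i \<in> S \<Longrightarrow> i \<noteq> j \<Longrightarrow> p i = q i"
  shows "p = q"
proof
  fix i
  have agree: "p i = q i" if "i \<noteq> j" for i
    using assms that by (cases "i \<in> S") (auto simp: permutes_not_in)
  show "p i = q i"
  proof (cases "i = j")
    case True
    obtain l where l: "q l = p j" using permutes_surj[OF assms(2)] by (metis surjD)
    hence "l = j"
      using agree[of l] permutes_inj[OF assms(1)] by (metis injD)
    thus ?thesis using l True by simp
  qed (use agree in auto)
qed

text \<open>
  Andreief's identity for a product of weights of which all but at most the \<open>j\<close>-th one make the
  functions \<open>\<phi>\<close> orthogonal: two permutations that differ do so at two places, so only the diagonal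
  terms survive.
\<close>

lemma has_bochner_integral_det_square:
  fixes \<phi> g :: "nat \<Rightarrow> 'b \<Rightarrow> complex"
  assumes M: "sigma_finite_measure M"
    and int: "\<And>i k l. i < n \<Longrightarrow> k < n \<Longrightarrow> l < n \<Longrightarrow> integrable M (\<lambda>x. g i x * (\<phi> k x * \<phi> l x))"
    and orth: "\<And>i k l. i < n \<Longrightarrow> i \<noteq> j \<Longrightarrow> k < n \<Longrightarrow> l < n \<Longrightarrow> k \<noteq> l \<Longrightarrow> (\<integral>x. g i x * (\<phi> k x * \<phi> l x) \<partial>M) = 0"
  shows "has_bochner_integral (\<Pi>\<^sub>M i\<in>{..<n}. M)
           (\<lambda>x. (\<Prod>i<n. g i (x i)) * (Determinant.det (Matrix.mat n n (\<lambda>(i, k). \<phi> k (x i))))\<^sup>2)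
           (\<Sum>\<sigma> | \<sigma> permutes {..<n}. \<Prod>i<n. \<integral>x. g i x * (\<phi> (\<sigma> i) x)\<^sup>2 \<partial>M)"
proof -
  interpret product_sigma_finite "\<lambda>_. M" by (simp add: product_sigma_finite_def M)
  let ?S = "{\<sigma>. \<sigma> permutes {..<n}}"
  let ?T = "\<lambda>\<sigma> \<tau> i x. g i x * (\<phi> (\<sigma> i) x * \<phi> (\<tau> i) x)"
  have fin: "finite ?S" by (simp add: finite_permutations)
  \<comment> \<open>The Leibniz formula for both factors yields products of functions of one
    coordinate each, to which Fubini applies.\<close>
  have expand: "(\<Prod>i<n. g i (x i)) * (Determinant.det (Matrix.mat n n (\<lambda>(i, k). \<phi> k (x i))))\<^sup>2 =
      (\<Sum>\<sigma>\<in>?S. \<Sum>\<tau>\<in>?S. (of_int (sign \<sigma>) * of_int (sign \<tau>)) * (\<Prod>i<n. ?T \<sigma> \<tau> i (x i)))" for x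
  proof -
    have "Determinant.det (Matrix.mat n n (\<lambda>(i, k). \<phi> k (x i))) =
        (\<Sum>\<sigma>\<in>?S. of_int (sign \<sigma>) * (\<Prod>i<n. \<phi> (\<sigma> i) (x i)))"
      by (subst det_def'[of _ n]) (auto simp: atLeast0LessThan permutes_in_image intro!: sum.cong prod.cong)
    thus ?thesis
      by (simp add: power2_eq_square sum_product sum_distrib_left prod.distrib mult_ac)
  qed
  have intT: "integrable M (?T \<sigma> \<tau> i)" if "\<sigma> \<in> ?S" "\<tau> \<in> ?S" "i < n" for \<sigma> \<tau> i
    using that permutes_in_image[of \<sigma> "{..<n}" i] permutes_in_image[of \<tau> "{..<n}" i] by (intro int) auto
  have "has_bochner_integral (\<Pi>\<^sub>M i\<in>{..<n}. M) (\<lambda>x. \<Prod>i<n. ?T \<sigma> \<tau> i (x i)) (\<Prod>i<n. \<integral>x. ?T \<sigma> \<tau> i x \<partial>M)"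
    if "\<sigma> \<in> ?S" "\<tau> \<in> ?S" for \<sigma> \<tau>
    unfolding has_bochner_integral_iff
    using product_integrable_prod[of "{..<n}" "?T \<sigma> \<tau>"] product_integral_prod[of "{..<n}" "?T \<sigma> \<tau>"] intT that by auto
  hence "has_bochner_integral (\<Pi>\<^sub>M i\<in>{..<n}. M)
      (\<lambda>x. \<Sum>\<sigma>\<in>?S. \<Sum>\<tau>\<in>?S. (of_int (sign \<sigma>) * of_int (sign \<tau>)) * (\<Prod>i<n. ?T \<sigma> \<tau> i (x i)))
      (\<Sum>\<sigma>\<in>?S. \<Sum>\<tau>\<in>?S. (of_int (sign \<sigma>) * of_int (sign \<tau>)) * (\<Prod>i<n. \<integral>x. ?T \<sigma> \<tau> i x \<partial>M))"
    by (intro has_bochner_integral_sum has_bochner_integral_mult_right)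
  moreover have "(\<Sum>\<sigma>\<in>?S. \<Sum>\<tau>\<in>?S. (of_int (sign \<sigma>) * of_int (sign \<tau>)) * (\<Prod>i<n. \<integral>x. ?T \<sigma> \<tau> i x \<partial>M)) =
      (\<Sum>\<sigma>\<in>?S. \<Sum>\<tau>\<in>?S. if \<sigma> = \<tau> then \<Prod>i<n. \<integral>x. g i x * (\<phi> (\<sigma> i) x)\<^sup>2 \<partial>M else 0)"
  proof (intro sum.cong refl)
    fix \<sigma> \<tau> assume st: "\<sigma> \<in> ?S" "\<tau> \<in> ?S"
    show "(of_int (sign \<sigma>) * of_int (sign \<tau>)) * (\<Prod>i<n. \<integral>x. ?T \<sigma> \<tau> i x \<partial>M) =
        (if \<sigma> = \<tau> then \<Prod>i<n. \<integral>x. g i x * (\<phi> (\<sigma> i) x)\<^sup>2 \<partial>M else 0)"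
    proof (cases "\<sigma> = \<tau>")
      case True
      have "of_int (sign \<tau>) * of_int (sign \<tau>) = (1 :: complex)"
        by (simp add: sign_def)
      thus ?thesis using True by (simp add: power2_eq_square)
    next
      case False
      then obtain i where i: "i < n" "i \<noteq> j" "\<sigma> i \<noteq> \<tau> i"
        using permutes_eq_of_agree_except[of \<sigma> "{..<n}" \<tau> j] st by auto
      have "(\<integral>x. ?T \<sigma> \<tau> i x \<partial>M) = 0"
        using i st permutes_in_image[of \<sigma> "{..<n}" i] permutes_in_image[of \<tau> "{..<n}" i] by (intro orth) auto
      hence "(\<Prod>i<n. \<integral>x. ?T \<sigma> \<tau> i x \<partial>M) = 0" using i by (auto simp: prod_zero_iff)
      thus ?thesis using False by simp
    qed
  qed
  moreover have "\<dots> = (\<Sum>\<sigma>\<in>?S. \<Prod>i<n. \<integral>x. g i x * (\<phi> (\<sigma> i) x)\<^sup>2 \<partial>M)"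
    using fin by simp
  ultimately show ?thesis by (simp add: expand)
qed

lemma sum_permutations_prod:
  fixes h :: "nat \<Rightarrow> 'a::field_char_0"
  shows "(\<Sum>\<sigma> | \<sigma> permutes {..<n}. \<Prod>i<n. h (\<sigma> i)) = fact n * (\<Prod>k<n. h k)"
proof -
  have "(\<Sum>\<sigma> | \<sigma> permutes {..<n}. \<Prod>i<n. h (\<sigma> i)) = (\<Sum>\<sigma> | \<sigma> permutes {..<n}. \<Prod>k<n. h k)"
    by (intro sum.cong refl) (metis (no_types, lifting) comp_apply mem_Collect_eq prod.cong prod.permute)
  thus ?thesis by (simp add: card_permutations)
qed

text \<open>Marking place \<open>j\<close> multiplies the unmarked product by
  \<open>A (\<sigma> j) / h (\<sigma> j)\<close>. For fixed \<open>\<sigma>\<close> the sum of these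
  ratios over \<open>j\<close> does not depend on \<open>\<sigma>\<close>.\<close>

lemma sum_permutations_prod_marked:
  fixes h A :: "nat \<Rightarrow> 'a::field_char_0"
  assumes nz: "\<And>k. k < n \<Longrightarrow> h k \<noteq> 0"
  shows "(\<Sum>j<n. \<Sum>\<sigma> | \<sigma> permutes {..<n}. \<Prod>i<n. if i = j then A (\<sigma> i) else h (\<sigma> i)) =
           fact n * (\<Prod>k<n. h k) * (\<Sum>k<n. A k / h k)"
proof -
  have "(\<Sum>j<n. \<Prod>i<n. if i = j then A (\<sigma> i) else h (\<sigma> i)) = (\<Prod>i<n. h (\<sigma> i)) * (\<Sum>k<n. A k / h k)"
    if \<sigma>: "\<sigma> permutes {..<n}" for \<sigma>
  proof -
    have "(\<Prod>i<n. if i = j then A (\<sigma> i) else h (\<sigma> i)) = (\<Prod>i<n. h (\<sigma> i)) * (A (\<sigma> j) / h (\<sigma> j))" if j: "j < n" for j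
    proof -
      have "(\<Prod>i<n. if i = j then A (\<sigma> i) else h (\<sigma> i)) = A (\<sigma> j) * (\<Prod>i\<in>{..<n} - {j}. h (\<sigma> i))"
        using j by (subst prod.remove[of _ j]) (auto intro!: prod.cong)
      moreover have "(\<Prod>i<n. h (\<sigma> i)) = h (\<sigma> j) * (\<Prod>i\<in>{..<n} - {j}. h (\<sigma> i))"
        using j by (intro prod.remove) auto
      moreover have "h (\<sigma> j) \<noteq> 0" using nz[of "\<sigma> j"] permutes_in_image[OF \<sigma>, of j] j by auto
      ultimately show ?thesis by simp
    qed
    hence "(\<Sum>j<n. \<Prod>i<n. if i = j then A (\<sigma> i) else h (\<sigma> i)) = (\<Prod>i<n. h (\<sigma> i)) * (\<Sum>j<n. A (\<sigma> j) / h (\<sigma> j))"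
      by (simp add: sum_distrib_left)
    also have "(\<Sum>j<n. A (\<sigma> j) / h (\<sigma> j)) = (\<Sum>k<n. A k / h k)"
      using sum.permute[OF \<sigma>, of "\<lambda>k. A k / h k"] by (simp add: o_def)
    finally show ?thesis .
  qed
  thus ?thesis
    by (subst sum.swap) (simp add: sum_permutations_prod flip: sum_distrib_right)
qed

section \<open>The moments for beta = 2\<close>

text \<open>The two indicators differ only at 0, where \<open>0 powr \<alpha> = 0\<close> makes both
  sides vanish.\<close>

lemma of_real_gamma_weight:
  "complex_of_real (indicator {0..} y * (y powr \<alpha> * exp (- y))) = gamma_weight (of_real \<alpha>) y"
  by (cases y "0 :: real" rule: linorder_cases)
     (auto simp: gamma_weight_def powr_of_real exp_minus divide_inverse)

lemma gamma_weight_mult_powr: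
  "gamma_weight a y * of_real y powr z = gamma_weight (a + z) y"
  by (simp add: gamma_weight_def powr_add)

text \<open>The exponent 2 removes the absolute values, leaving the squared Vandermonde product. The
  denominator corrects for the leading coefficients (-1)^k / k! of the polynomials.\<close>

lemma laguerre_weight_2_eq_det:
  "complex_of_real (laguerre_weight 2 \<alpha> N x) =
     (\<Prod>i<N. gamma_weight (of_real \<alpha>) (x i)) *
     (Determinant.det (Matrix.mat N N (\<lambda>(i, k). poly (laguerre_poly (of_real \<alpha>) k) (of_real (x i)))))\<^sup>2 /
     (\<Prod>k<N. (-1) ^ k / fact k)\<^sup>2"
proof -
  let ?V = "\<Prod>j<N. \<Prod>i<j. x j - x i"
  have "\<bar>y\<bar> powr 2 = y\<^sup>2" for y :: real
    by (cases "y = 0") auto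
  hence "laguerre_weight 2 \<alpha> N x = (\<Prod>j<N. indicator {0..} (x j) * (x j powr \<alpha> * exp (- x j))) * ?V\<^sup>2"
    by (simp add: laguerre_weight_def prod_power_distrib)
  hence "complex_of_real (laguerre_weight 2 \<alpha> N x) =
      (\<Prod>i<N. gamma_weight (of_real \<alpha>) (x i)) * (of_real ?V)\<^sup>2"
    by (simp only: of_real_mult of_real_prod of_real_power flip: of_real_gamma_weight)
  moreover have "Determinant.det (Matrix.mat N N (\<lambda>(i, k). poly (laguerre_poly (of_real \<alpha>) k) (of_real (x i)))) =
      (\<Prod>k<N. (-1) ^ k / fact k) * of_real ?V"
    by (subst det_poly_Vandermonde[where x = "\<lambda>i. complex_of_real (x i)"])
       (simp_all add: degree_laguerre_poly_le coeff_laguerre_poly)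
  moreover have "(\<Prod>k<N. (-1) ^ k / fact k :: complex) \<noteq> 0" by simp
  ultimately show ?thesis by (simp add: power_mult_distrib)
qed

text \<open>Each coordinate carries its own exponent so that one statement serves both the
  normalization and the insertion of a power of a single eigenvalue.\<close>

lemma has_bochner_integral_laguerre_weight_aux:
  assumes "\<alpha> > -1" "\<And>i. i < N \<Longrightarrow> Re (a i) > -1" "\<And>i. i < N \<Longrightarrow> i \<noteq> j \<Longrightarrow> a i = of_real \<alpha>"
  shows "has_bochner_integral (\<Pi>\<^sub>M i\<in>{..<N}. lborel)
           (\<lambda>x. (\<Prod>i<N. gamma_weight (a i) (x i)) *
             (Determinant.det (Matrix.mat N N (\<lambda>(i, k). poly (laguerre_poly (of_real \<alpha>) k) (of_real (x i)))))\<^sup>2)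
           (\<Sum>\<sigma> | \<sigma> permutes {..<N}. \<Prod>i<N.
             \<integral>x. gamma_weight (a i) x * (poly (laguerre_poly (of_real \<alpha>) (\<sigma> i)) (of_real x))\<^sup>2 \<partial>lborel)"
proof (rule has_bochner_integral_det_square[where j = j])
  show "sigma_finite_measure (lborel :: real measure)" by unfold_locales
next
  fix i k l assume "i < N"
  thus "integrable lborel (\<lambda>x. gamma_weight (a i) x *
      (poly (laguerre_poly (of_real \<alpha>) k) (of_real x) * poly (laguerre_poly (of_real \<alpha>) l) (of_real x)))"
    using integrable_gamma_weight_poly[OF assms(2), of i "laguerre_poly (of_real \<alpha>) k * laguerre_poly (of_real \<alpha>) l"]
    by simp
next
  fix i k l assume "i < N" "i \<noteq> j" "k \<noteq> (l :: nat)"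
  thus "(\<integral>x. gamma_weight (a i) x *
      (poly (laguerre_poly (of_real \<alpha>) k) (of_real x) * poly (laguerre_poly (of_real \<alpha>) l) (of_real x)) \<partial>lborel) = 0"
    using assms by (simp add: laguerre_poly_orthogonal)
qed

text \<open>Numerator and normalization are both sums over permutations. The common factor
  \<open>fact N * (\<Prod>k<N. h k) / c\<close> cancels and leaves the ratios
  \<open>A k / h k\<close>.\<close>

lemma laguerre_moment_2_eq:
  fixes \<alpha> :: real and z :: complex
  assumes \<alpha>: "\<alpha> > -1" and z: "Re z > - \<alpha> - 1"
  shows "laguerre_moment 2 N z \<alpha> =
    (\<Sum>k<N. (\<integral>x. gamma_weight (of_real \<alpha> + z) x * (poly (laguerre_poly (of_real \<alpha>) k) (of_real x))\<^sup>2 \<partial>lborel) /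
       (Gamma (of_real \<alpha> + 1) * rising_binomial (of_real \<alpha> + 1) k))"
proof -
  let ?M = "\<Pi>\<^sub>M i\<in>{..<N}. (lborel :: real measure)"
  let ?D = "\<lambda>x. Determinant.det (Matrix.mat N N (\<lambda>(i, k). poly (laguerre_poly (of_real \<alpha>) k) (of_real (x i))))"
  let ?w = "laguerre_weight 2 \<alpha> N"
  define h :: "nat \<Rightarrow> complex" where "h k = Gamma (of_real \<alpha> + 1) * rising_binomial (of_real \<alpha> + 1) k" for k
  define A where "A k = (\<integral>x. gamma_weight (of_real \<alpha> + z) x * (poly (laguerre_poly (of_real \<alpha>) k) (of_real x))\<^sup>2 \<partial>lborel)" for k
  define c :: complex where "c = (\<Prod>k<N. (-1) ^ k / fact k)\<^sup>2"
  have c: "c \<noteq> 0" by (simp add: c_def)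
  have h: "h k \<noteq> 0" for k
    using \<alpha> Gamma_nonzero_of_Re_pos[of "of_real \<alpha> + 1"] rising_binomial_nonzero[of "of_real \<alpha> + 1" k] by (simp add: h_def)
  have h_eq: "h k = (\<integral>x. gamma_weight (of_real \<alpha>) x * (poly (laguerre_poly (of_real \<alpha>) k) (of_real x))\<^sup>2 \<partial>lborel)" for k
    using laguerre_poly_orthogonal[of "of_real \<alpha>" k k] \<alpha> by (simp add: h_def power2_eq_square)
  define Zc where "Zc = fact N * (\<Prod>k<N. h k) / c"
  have Zc: "Zc \<noteq> 0" using c h by (simp add: Zc_def)
  have weight: "has_bochner_integral ?M (\<lambda>x. complex_of_real (?w x)) Zc"
  proof -
    have "has_bochner_integral ?M (\<lambda>x. (\<Prod>i<N. gamma_weight (of_real \<alpha>) (x i)) * (?D x)\<^sup>2)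
        (\<Sum>\<sigma> | \<sigma> permutes {..<N}. \<Prod>i<N. h (\<sigma> i))"
      \<comment> \<open>\<open>j = N\<close> lies outside the index range, so no coordinate is
        exceptional.\<close>
      unfolding h_eq by (rule has_bochner_integral_laguerre_weight_aux[where j = N]) (use \<alpha> in auto)
    hence "has_bochner_integral ?M (\<lambda>x. (\<Prod>i<N. gamma_weight (of_real \<alpha>) (x i)) * (?D x)\<^sup>2 / c) Zc"
      unfolding sum_permutations_prod Zc_def by (intro has_bochner_integral_divide_zero)
    thus ?thesis by (simp add: laguerre_weight_2_eq_det c_def)
  qed
  have moment: "has_bochner_integral ?M (\<lambda>x. complex_of_real (?w x) * (\<Sum>j<N. of_real (x j) powr z))
      (Zc * (\<Sum>k<N. A k / h k))"
  proof -
    \<comment> \<open>The power of the \<open>j\<close>-th eigenvalue is absorbed into the exponent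
      of its own weight.\<close>
    have "has_bochner_integral ?M
        (\<lambda>x. (\<Prod>i<N. gamma_weight (if i = j then of_real \<alpha> + z else of_real \<alpha>) (x i)) * (?D x)\<^sup>2)
        (\<Sum>\<sigma> | \<sigma> permutes {..<N}. \<Prod>i<N. if i = j then A (\<sigma> i) else h (\<sigma> i))" for j
    proof -
      have "(if i = j then A (\<sigma> i) else h (\<sigma> i)) =
        (\<integral>x. gamma_weight (if i = j then of_real \<alpha> + z else of_real \<alpha>) x *
           (poly (laguerre_poly (of_real \<alpha>) (\<sigma> i)) (of_real x))\<^sup>2 \<partial>lborel)" for i \<sigma>
        by (simp add: A_def h_eq)
      thus ?thesis
        by (simp only:) (rule has_bochner_integral_laguerre_weight_aux[where j = j], use \<alpha> z in auto)
    qed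
    hence "has_bochner_integral ?M
        (\<lambda>x. (\<Sum>j<N. (\<Prod>i<N. gamma_weight (if i = j then of_real \<alpha> + z else of_real \<alpha>) (x i)) * (?D x)\<^sup>2) / c)
        ((\<Sum>j<N. \<Sum>\<sigma> | \<sigma> permutes {..<N}. \<Prod>i<N. if i = j then A (\<sigma> i) else h (\<sigma> i)) / c)"
      by (intro has_bochner_integral_divide_zero has_bochner_integral_sum)
    moreover have "(\<Sum>j<N. \<Sum>\<sigma> | \<sigma> permutes {..<N}. \<Prod>i<N. if i = j then A (\<sigma> i) else h (\<sigma> i)) / c =
        Zc * (\<Sum>k<N. A k / h k)"
      by (subst sum_permutations_prod_marked) (simp_all add: h Zc_def)
    moreover have "(\<Sum>j<N. (\<Prod>i<N. gamma_weight (if i = j then of_real \<alpha> + z else of_real \<alpha>) (x i)) * (?D x)\<^sup>2) / c =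
        complex_of_real (?w x) * (\<Sum>j<N. of_real (x j) powr z)" for x
    proof -
      have "(\<Prod>i<N. gamma_weight (if i = j then of_real \<alpha> + z else of_real \<alpha>) (x i)) =
          (\<Prod>i<N. gamma_weight (of_real \<alpha>) (x i)) * of_real (x j) powr z" if "j < N" for j
      proof -
        have "(\<Prod>i<N. gamma_weight (if i = j then of_real \<alpha> + z else of_real \<alpha>) (x i)) =
            gamma_weight (of_real \<alpha> + z) (x j) * (\<Prod>i\<in>{..<N} - {j}. gamma_weight (of_real \<alpha>) (x i))"
          using that by (subst prod.remove[of _ j]) (auto intro!: prod.cong)
        moreover have "(\<Prod>i<N. gamma_weight (of_real \<alpha>) (x i)) =
            gamma_weight (of_real \<alpha>) (x j) * (\<Prod>i\<in>{..<N} - {j}. gamma_weight (of_real \<alpha>) (x i))"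
          using that by (intro prod.remove) auto
        ultimately show ?thesis by (simp add: mult_ac flip: gamma_weight_mult_powr)
      qed
      thus ?thesis
        by (simp add: laguerre_weight_2_eq_det c_def sum_distrib_left sum_distrib_right sum_divide_distrib mult_ac)
    qed
    ultimately show ?thesis by simp
  qed
  define Z where "Z = (\<integral>x. ?w x \<partial>?M)"
  have w_int: "integrable ?M ?w"
    using weight by (simp add: has_bochner_integral_iff complex_of_real_integrable_eq)
  have w_meas: "?w \<in> borel_measurable ?M" using w_int by (rule borel_measurable_integrable)
  have w_nonneg: "?w x \<ge> 0" for x
    by (auto simp: laguerre_weight_def intro!: mult_nonneg_nonneg prod_nonneg)
  have Z_eq: "complex_of_real Z = Zc"
    using weight by (simp add: has_bochner_integral_iff Z_def)
  \<comment> \<open>Positivity turns the \<open>ennreal\<close> quotient in the ensemble into the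
    real density \<open>?w x / Z\<close>. It follows from the nonnegative weight and the explicit
    nonzero value \<open>Zc\<close>.\<close>
  have Z: "Z > 0"
  proof -
    have "Z \<ge> 0" unfolding Z_def by (intro integral_nonneg_AE) (simp add: w_nonneg)
    moreover have "Z \<noteq> 0" using Z_eq Zc by auto
    ultimately show ?thesis by simp
  qed
  have "(\<integral>\<^sup>+ y. ennreal (?w y) \<partial>?M) = ennreal Z"
    unfolding Z_def by (intro nn_integral_eq_integral w_int) (simp add: w_nonneg)
  hence ens: "laguerre_ensemble 2 \<alpha> N = density ?M (\<lambda>x. ennreal (?w x / Z))"
    using Z by (simp add: laguerre_ensemble_def divide_ennreal w_nonneg)
  have "laguerre_moment 2 N z \<alpha> = (\<integral>x. (?w x / Z) *\<^sub>R (\<Sum>j<N. complex_of_real (x j) powr z) \<partial>?M)"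
    unfolding laguerre_moment_def ens
  proof (rule integral_density)
    show "(\<lambda>x. \<Sum>j<N. complex_of_real (x j) powr z) \<in> borel_measurable ?M"
    proof (rule borel_measurable_sum)
      fix j assume "j \<in> {..<N}"
      thus "(\<lambda>x. complex_of_real (x j) powr z) \<in> borel_measurable ?M"
        using measurable_component_singleton[of j "{..<N}" "\<lambda>_. lborel"]
          measurable_compose[of "\<lambda>x. x j" ?M lborel "\<lambda>y. complex_of_real y powr z" borel] by simp
    qed
    show "(\<lambda>x. ?w x / Z) \<in> borel_measurable ?M" using w_meas by simp
    show "AE x in ?M. 0 \<le> ?w x / Z" using Z w_nonneg by simp
  qed
  also have "\<dots> = (\<integral>x. complex_of_real (?w x) * (\<Sum>j<N. of_real (x j) powr z) / of_real Z \<partial>?M)"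
    by (simp add: scaleR_conv_of_real)
  also have "\<dots> = Zc * (\<Sum>k<N. A k / h k) / of_real Z"
    using has_bochner_integral_integral_eq[OF has_bochner_integral_divide_zero[OF moment, of "of_real Z"]] .
  also have "\<dots> = (\<Sum>k<N. A k / h k)" using Zc by (simp add: Z_eq)
  finally show ?thesis unfolding A_def h_def .
qed

section \<open>The limit of the inverse moments\<close>

theorem theorem1p2:
  fixes \<alpha> :: real and s :: complex
  assumes "\<alpha> > - 1 / 2"
    and "1 / 2 < Re s" and "Re s < \<alpha> + 1"
  shows "(\<lambda>N. of_nat N powr (- s) * laguerre_moment 2 N (- s) \<alpha>) \<longlonglongrightarrow>
           4 powr (s - 1) * Gamma (of_real \<alpha> + 1 - s) * Gamma (s - 1 / 2) /
           (of_real (sqrt pi) * Gamma (s + 1) * Gamma (s + of_real \<alpha>))"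
proof -
  have \<alpha>: "\<alpha> > -1" using assms by simp
  define a where "a = complex_of_real \<alpha>"
  define q where "q = a - s + 1"
  \<comment> \<open>\<open>Re q > 0\<close> is the upper bound on \<open>Re s\<close>, and
    \<open>Re (a + s) > 0\<close> combines both lower bounds.\<close>
  have Re: "Re s > 0" "Re (2 * s - 1) > 0" "Re q > 0" "Re (a + 1) > 0" "Re (a + s) > 0"
    using assms by (auto simp: a_def q_def)
  define c where "c k = (\<Sum>j\<le>k. (rising_binomial s (k - j))\<^sup>2 * rising_binomial q j)" for k
  define b where "b k = Gamma q * c k / (Gamma (a + 1) * rising_binomial (a + 1) k)" for k
  have moment: "laguerre_moment 2 N (- s) \<alpha> = (\<Sum>k<N. b k)" for N
  proof -
    have "laguerre_moment 2 N (- s) \<alpha> =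
      (\<Sum>k<N. (\<integral>x. gamma_weight (a - s) x * (poly (laguerre_poly a k) (of_real x))\<^sup>2 \<partial>lborel) /
         (Gamma (a + 1) * rising_binomial (a + 1) k))"
      using laguerre_moment_2_eq[OF \<alpha>, of "- s" N] assms by (simp add: a_def)
    thus ?thesis
      using integral_laguerre_poly_square[of "a - s" a] Re by (simp add: b_def c_def q_def)
  qed
  have "(\<lambda>k. c k / rising_binomial (2 * s - 1 + q) k) \<longlonglongrightarrow> Gamma (2 * s - 1) / (Gamma s)\<^sup>2"
    unfolding c_def
    by (rule convolution_rising_binomial_asymp[OF _ _ rising_binomial_square_ratio]) (use Re assms in auto)
  moreover have "2 * s - 1 + q = a + s" by (simp add: q_def)
  ultimately have lim_c: "(\<lambda>k. c k / rising_binomial (a + s) k) \<longlonglongrightarrow> Gamma (2 * s - 1) / (Gamma s)\<^sup>2"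
    by simp
  \<comment> \<open>The quotients with parameters \<open>a + s\<close>, \<open>a + 1\<close> and
    with \<open>s\<close>, \<open>1\<close> have the same growth k^(s - 1). Dividing one by the
    other cancels the powers of \<open>k\<close> and converts the denominator
    \<open>rising_binomial (a + 1) k\<close> of \<open>b k\<close> into
    \<open>rising_binomial s k\<close>.\<close>
  have "(\<lambda>k. Gamma q / Gamma (a + 1) * (c k / rising_binomial (a + s) k *
      ((rising_binomial (a + s) k / rising_binomial (a + 1) k * of_nat k powr ((a + 1) - (a + s))) /
       (rising_binomial s k / rising_binomial 1 k * of_nat k powr (1 - s)))))
    \<longlonglongrightarrow> Gamma q / Gamma (a + 1) * (Gamma (2 * s - 1) / (Gamma s)\<^sup>2 *
         ((Gamma (a + 1) / Gamma (a + s)) / (Gamma 1 / Gamma s)))"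
    by (rule tendsto_mult[OF tendsto_const tendsto_mult[OF lim_c
          tendsto_divide[OF rising_binomial_ratio rising_binomial_ratio]]])
       (use Re Gamma_nonzero_of_Re_pos in auto)
  moreover have "\<forall>\<^sub>F k in sequentially. Gamma q / Gamma (a + 1) * (c k / rising_binomial (a + s) k *
      ((rising_binomial (a + s) k / rising_binomial (a + 1) k * of_nat k powr ((a + 1) - (a + s))) /
       (rising_binomial s k / rising_binomial 1 k * of_nat k powr (1 - s)))) = b k / rising_binomial s k"
    using eventually_gt_at_top[of 0]
  proof eventually_elim
    case (elim k)
    have "(of_nat k :: complex) powr (1 - s) \<noteq> 0" using elim by simp
    thus ?case
      using rising_binomial_nonzero[of "a + s" k] Re by (simp add: b_def)
  qed
  moreover have "Gamma q / Gamma (a + 1) * (Gamma (2 * s - 1) / (Gamma s)\<^sup>2 *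
         ((Gamma (a + 1) / Gamma (a + s)) / (Gamma 1 / Gamma s))) =
       Gamma q * Gamma (2 * s - 1) / (Gamma s * Gamma (a + s))"
    using Re Gamma_nonzero_of_Re_pos by (simp add: power2_eq_square)
  ultimately have "(\<lambda>k. b k / rising_binomial s k) \<longlonglongrightarrow> Gamma q * Gamma (2 * s - 1) / (Gamma s * Gamma (a + s))"
    by (simp only: tendsto_cong)
  hence "(\<lambda>N. of_nat N powr (- s) * (\<Sum>k<N. b k)) \<longlonglongrightarrow>
      Gamma q * Gamma (2 * s - 1) / (Gamma s * Gamma (a + s)) / Gamma (s + 1)"
    using Re by (intro partial_sum_rising_binomial_asymp)
  moreover have "Gamma q * Gamma (2 * s - 1) / (Gamma s * Gamma (a + s)) / Gamma (s + 1) =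
      4 powr (s - 1) * Gamma (of_real \<alpha> + 1 - s) * Gamma (s - 1 / 2) /
           (of_real (sqrt pi) * Gamma (s + 1) * Gamma (s + of_real \<alpha>))"
  proof -
    \<comment> \<open>Duplication at \<open>s - 1 / 2\<close>, which pairs it with \<open>s\<close>
      and doubles to \<open>2 * s - 1\<close>; the power of 2 it produces is the inverse of
      \<open>4 powr (s - 1)\<close>.\<close>
    have "s - 1 / 2 \<notin> \<int>\<^sub>\<le>\<^sub>0" "s - 1 / 2 + 1 / 2 \<notin> \<int>\<^sub>\<le>\<^sub>0"
      using assms by (auto elim!: nonpos_Ints_cases simp: complex_eq_iff)
    from Gamma_legendre_duplication[OF this]
    have dup: "Gamma (s - 1 / 2) * Gamma s = exp ((2 - 2 * s) * of_real (ln 2)) * of_real (sqrt pi) * Gamma (2 * s - 1)"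
      by (simp add: algebra_simps)
    have "ln (4 :: real) = 2 * ln 2" using ln_realpow[of 2 2] by simp
    hence four: "(4 :: complex) powr (s - 1) = exp ((2 * s - 2) * of_real (ln 2))"
      using Ln_of_real[of 4] by (simp add: powr_def algebra_simps)
    have "4 powr (s - 1) * exp ((2 - 2 * s) * of_real (ln 2)) = (1 :: complex)"
      unfolding four by (simp add: algebra_simps flip: exp_add)
    hence "4 powr (s - 1) * (Gamma (s - 1 / 2) * Gamma s) = of_real (sqrt pi) * Gamma (2 * s - 1)"
      unfolding dup by (simp flip: mult.assoc)
    hence "Gamma (2 * s - 1) / Gamma s = 4 powr (s - 1) * Gamma (s - 1 / 2) / of_real (sqrt pi)"
      using Gamma_nonzero_of_Re_pos[of s] Re by (simp add: field_simps)
    hence "Gamma q * (Gamma (2 * s - 1) / Gamma s) / (Gamma (s + 1) * Gamma (a + s)) =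
      Gamma q * (4 powr (s - 1) * Gamma (s - 1 / 2) / of_real (sqrt pi)) / (Gamma (s + 1) * Gamma (a + s))"
      by (simp only:)
    moreover have "q = of_real \<alpha> + 1 - s" by (simp add: q_def a_def)
    ultimately show ?thesis by (simp add: a_def mult_ac add.commute)
  qed
  ultimately show ?thesis by (simp only: moment)
qed

end
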